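(* For arbitrary $su(n)$, let $(D_a)_{bc}=d_{abc}$, $a,b,c=1,\dots,n^2-1$. Then $$\mathrm{Tr}\,D_{(a}D_bD_cD_dD_{e)}=\frac{n^2-80}{8n}\,d^{(5)}_{(abcde)}+\frac{3n^2-20}{n^2}\,\delta_{(ab}d_{cde)} .$$
   Context: The totally symmetric traceless $su(n)$ tensor $d_{abc}$ is defined from the hermitian traceless $n\times n$ matrices $T_a$, $a=1,\dots,n^2-1$, normalised by $\mathrm{Tr}(T_aT_b)=\frac12\delta_{ab}$, through $\{T_a,T_b\}=\frac1n\delta_{ab}+d_{abc}T_c$. Repeated indices are summed; round brackets denote unit-weight symmetrisation over the enclosed free indices. $d^{(5)}_{abcde}=d_{abx}d_{xcy}d_{yde}$. *)

theory Defs
  imports "HOL-Analysis.Analysis" "HOL-Combinatorics.Permutations"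
begin

definition kdelta :: "'a \<Rightarrow> 'a \<Rightarrow> real" where
  "kdelta a b = (if a = b then 1 else 0)"

definition hermitian_matrix :: "complex ^ 'n ^ 'n \<Rightarrow> bool" where
  "hermitian_matrix A \<longleftrightarrow> (\<forall>i j. A $ i $ j = cnj (A $ j $ i))"

definition anticommutator :: "complex ^ 'n ^ 'n \<Rightarrow> complex ^ 'n ^ 'n \<Rightarrow> complex ^ 'n ^ 'n" where
  "anticommutator A B = A ** B + B ** A"

(* Here n = CARD('n), and the type 'a of labels a = 1, ..., n^2 - 1 has n^2 - 1 elements.
   As types are nonempty, the cardinality condition forces n >= 2. *)

definition su_generators :: "('a::finite \<Rightarrow> complex ^ 'n ^ 'n) \<Rightarrow> bool" where
  "su_generators T \<longleftrightarrow>
     CARD('a) = CARD('n) ^ 2 - 1 \<and>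
     (\<forall>a. hermitian_matrix (T a)) \<and>
     (\<forall>a. trace (T a) = 0) \<and>
     (\<forall>a b. trace (T a ** T b) = of_real (kdelta a b / 2))"

(* The T a are linearly independent and, with the identity matrix, span all n x n matrices, so
   for given generators exactly one d satisfies this condition.  Its total symmetry is a
   consequence and is not assumed. *)

definition su_d_tensor ::
    "('a::finite \<Rightarrow> complex ^ 'n ^ 'n) \<Rightarrow> ('a \<Rightarrow> 'a \<Rightarrow> 'a \<Rightarrow> real) \<Rightarrow> bool" where
  "su_d_tensor T d \<longleftrightarrow>
     (\<forall>a b. anticommutator (T a) (T b)
            = (kdelta a b / real CARD('n)) *\<^sub>R mat 1 + (\<Sum>c\<in>UNIV. d a b c *\<^sub>R T c))"

definition d_matrix :: "('a::finite \<Rightarrow> 'a \<Rightarrow> 'a \<Rightarrow> real) \<Rightarrow> 'a \<Rightarrow> real ^ 'a ^ 'a" where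
  "d_matrix d a = (\<chi> b c. d a b c)"

definition d5_tensor ::
    "('a::finite \<Rightarrow> 'a \<Rightarrow> 'a \<Rightarrow> real) \<Rightarrow> 'a \<Rightarrow> 'a \<Rightarrow> 'a \<Rightarrow> 'a \<Rightarrow> 'a \<Rightarrow> real" where
  "d5_tensor d a b c p q = (\<Sum>x\<in>UNIV. \<Sum>y\<in>UNIV. d a b x * d x c y * d y p q)"

definition symmetrise5 ::
    "('a \<Rightarrow> 'a \<Rightarrow> 'a \<Rightarrow> 'a \<Rightarrow> 'a \<Rightarrow> real) \<Rightarrow> 'a \<Rightarrow> 'a \<Rightarrow> 'a \<Rightarrow> 'a \<Rightarrow> 'a \<Rightarrow> real" where
  "symmetrise5 F a b c p q =
     (let v = [a, b, c, p, q] in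
      (\<Sum>\<pi> | \<pi> permutes {..<5}.
          F (v ! \<pi> 0) (v ! \<pi> 1) (v ! \<pi> 2) (v ! \<pi> 3) (v ! \<pi> 4)) / fact 5)"

end

theory Submission
  imports Defs
begin

text \<open>By polarisation it suffices to compare the two sides after contracting all five indices with
  one vector x. Put X = x_a T_a and t_k = Tr X^k, so t_1 = 0. The matrix x_a D_a represents
  Y \<mapsto> XY + YX - (2/n) Tr(XY) on traceless matrices, and the completeness relation for the T_a
  turns its fifth trace into (2n - 160/n) t_5 + (20 + 160/n^2) t_2 t_3. The contractions on the right
  are 16 (t_5 - 2 t_2 t_3 / n) and 8 t_2 t_3.\<close>

section \<open>Contraction with a single vector and polarisation\<close>

text \<open>Each \<open>x\<close> factor multiplies everything to its right, so reversing
  \<open>sum_distrib_left\<close> moves it out of all inner sums and the five contractions can be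
  evaluated one at a time.\<close>

definition diag5 ::
    "('a::finite \<Rightarrow> 'a \<Rightarrow> 'a \<Rightarrow> 'a \<Rightarrow> 'a \<Rightarrow> real) \<Rightarrow> ('a \<Rightarrow> real) \<Rightarrow> real" where
  "diag5 F x = (\<Sum>a\<in>UNIV. \<Sum>b\<in>UNIV. \<Sum>c\<in>UNIV. \<Sum>p\<in>UNIV. \<Sum>q\<in>UNIV.
     x a * (x b * (x c * (x p * (x q * F a b c p q)))))"

lemma sum_kdelta_mult [simp]:
  fixes g :: "'a::finite \<Rightarrow> real"
  shows "(\<Sum>a\<in>UNIV. kdelta i a * g a) = g i" "(\<Sum>a\<in>UNIV. kdelta a i * g a) = g i"
  by (simp_all add: kdelta_def if_distrib[of "\<lambda>z. z * _"] cong: if_cong)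

lemma sum_indicator_mult:
  fixes g :: "'a::finite \<Rightarrow> real"
  shows "(\<Sum>a\<in>UNIV. (\<Sum>i\<in>S. kdelta (v i) a) * g a) = (\<Sum>i\<in>S. g (v i))"
  by (simp add: sum_distrib_right sum.swap[of _ S])

text \<open>Summing delta vectors counts coinciding labels with multiplicity, so the expansion runs
  over positions in \<open>S\<close> and \<open>v\<close> may repeat values.\<close>

lemma diag5_indicator:
  "diag5 F (\<lambda>a. \<Sum>i\<in>S. kdelta (v i) a)
     = (\<Sum>i\<in>S. \<Sum>j\<in>S. \<Sum>k\<in>S. \<Sum>l\<in>S. \<Sum>m\<in>S. F (v i) (v j) (v k) (v l) (v m))"
  by (simp add: diag5_def sum_indicator_mult flip: sum_distrib_left)

text \<open>If \<open>R\<close> is a proper subset of \<open>U\<close>, equally many sets between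
  them have even and odd size, so the signs cancel.\<close>

lemma sum_alternating_supersets:
  assumes "finite U" "R \<subseteq> U"
  shows "(\<Sum>S | S \<subseteq> U \<and> R \<subseteq> S. (-1) ^ card S :: real) = (if R = U then (-1) ^ card U else 0)"
proof (cases "R = U")
  case True
  then have "{S. S \<subseteq> U \<and> R \<subseteq> S} = {U}" by auto
  with True show ?thesis by simp
next
  case False
  with assms have "R \<subset> U" by auto
  from card_subsupersets_even_odd[OF assms(1) this] False show ?thesis
    using assms(1) by (simp add: sum_alternating_cancels conj_assoc)
qed

text \<open>Five entries that cover a set of five elements are distinct, so the tuple lists the
  values of exactly one permutation.\<close>

lemma bij_betw_permutations_tuples:
  "bij_betw (\<lambda>\<pi>. (\<pi> 0, \<pi> 1, \<pi> 2, \<pi> 3, \<pi> 4)) {\<pi>. \<pi> permutes {..<5::nat}}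
     {(i, j, k, l, m). {i, j, k, l, m} = {..<5}}"
proof -
  have five: "{..<5::nat} = {0, 1, 2, 3, 4}" by auto
  show ?thesis
    unfolding bij_betw_def
  proof (intro conjI)
    show "inj_on (\<lambda>\<pi>. (\<pi> 0, \<pi> 1, \<pi> 2, \<pi> 3, \<pi> 4)) {\<pi>. \<pi> permutes {..<5::nat}}"
    proof (rule inj_onI, rule ext)
      fix \<pi> \<rho> :: "nat \<Rightarrow> nat" and i
      assume *: "\<pi> \<in> {\<pi>. \<pi> permutes {..<5}}" "\<rho> \<in> {\<pi>. \<pi> permutes {..<5}}"
        "(\<pi> 0, \<pi> 1, \<pi> 2, \<pi> 3, \<pi> 4) = (\<rho> 0, \<rho> 1, \<rho> 2, \<rho> 3, \<rho> 4)"
      show "\<pi> i = \<rho> i"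
      proof (cases "i \<in> {..<5}")
        case True
        with * show ?thesis unfolding five by auto
      next
        case False
        with * show ?thesis by (simp add: permutes_not_in)
      qed
    qed
  next
    show "(\<lambda>\<pi>. (\<pi> 0, \<pi> 1, \<pi> 2, \<pi> 3, \<pi> 4)) ` {\<pi>. \<pi> permutes {..<5::nat}}
        = {(i, j, k, l, m). {i, j, k, l, m} = {..<5}}" (is "?f ` ?P = ?Q")
    proof (intro equalityI subsetI)
      fix t assume "t \<in> ?f ` ?P"
      then obtain \<pi> where "\<pi> permutes {..<5}" "t = ?f \<pi>" by auto
      then show "t \<in> ?Q" using permutes_image[of \<pi> "{..<5}"] by (auto simp: five)
    next
      fix t assume "t \<in> ?Q"
      then obtain i j k l m where t: "t = (i, j, k, l, m)" and im: "{i, j, k, l, m} = {..<5}"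
        by auto
      \<comment> \<open>\<open>permutes\<close> requires every index from 5 on to be fixed, hence
        the default \<open>r\<close>.\<close>
      define \<pi> where "\<pi> r = (if r < 5 then [i, j, k, l, m] ! r else r)" for r
      have im': "\<pi> ` {..<5} = {..<5}"
        using im by (simp add: five \<pi>_def)
      then have "inj_on \<pi> {..<5}" by (intro eq_card_imp_inj_on) auto
      with im' have "\<pi> permutes {..<5}"
        by (intro bij_imp_permutes) (auto simp: bij_betw_def \<pi>_def)
      moreover have "?f \<pi> = t" by (simp add: t \<pi>_def)
      ultimately show "t \<in> ?f ` ?P" by blast
    qed
  qed
qed

text \<open>The alternating sum over S cancels every index tuple that does not cover {..<5}.\<close>

lemma symmetrise5_polarisation:
  fixes F :: "'a::finite \<Rightarrow> 'a \<Rightarrow> 'a \<Rightarrow> 'a \<Rightarrow> 'a \<Rightarrow> real"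
  shows "symmetrise5 F a b c p q
    = - (\<Sum>S\<in>Pow {..<5::nat}. (-1) ^ card S
          * diag5 F (\<lambda>e. \<Sum>i\<in>S. kdelta ([a, b, c, p, q] ! i) e)) / fact 5"
proof -
  define v where "v = [a, b, c, p, q]"
  define U where "U = {..<5::nat}"
  define H where "H = (\<lambda>(i, j, k, l, m). F (v ! i) (v ! j) (v ! k) (v ! l) (v ! m))"
  define R where "R = (\<lambda>(i, j, k, l, m). {i, j, k, l, m :: nat})"
  have U [simp]: "finite U" "card U = 5" by (simp_all add: U_def)
  \<comment> \<open>Writing the sum over tuples from \<open>S\<close> as a conditional sum over a
    range independent of \<open>S\<close> allows the sums over \<open>S\<close> and over tuples to
    be exchanged.\<close>
  have diag: "diag5 F (\<lambda>e. \<Sum>i\<in>S. kdelta (v ! i) e)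
      = (\<Sum>t\<in>U \<times> U \<times> U \<times> U \<times> U. if R t \<subseteq> S then H t else 0)" if "S \<subseteq> U" for S
  proof -
    have "finite S" using that U(1) finite_subset by blast
    then have "diag5 F (\<lambda>e. \<Sum>i\<in>S. kdelta (v ! i) e) = (\<Sum>t\<in>S \<times> S \<times> S \<times> S \<times> S. H t)"
      by (simp add: diag5_indicator H_def sum.cartesian_product')
    also have "\<dots> = (\<Sum>t\<in>U \<times> U \<times> U \<times> U \<times> U. if R t \<subseteq> S then H t else 0)"
      using that by (intro sum.mono_neutral_cong_left) (auto simp: R_def)
    finally show ?thesis .
  qed
  have "(\<Sum>S\<in>Pow U. (-1) ^ card S * diag5 F (\<lambda>e. \<Sum>i\<in>S. kdelta (v ! i) e))
      = (\<Sum>S\<in>Pow U. \<Sum>t\<in>U \<times> U \<times> U \<times> U \<times> U. if R t \<subseteq> S then H t * (-1) ^ card S else 0)"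
    by (intro sum.cong refl) (auto simp: diag sum_distrib_left mult.commute intro!: sum.cong)
  also have "\<dots> = (\<Sum>t\<in>U \<times> U \<times> U \<times> U \<times> U. \<Sum>S\<in>Pow U.
      if R t \<subseteq> S then H t * (-1) ^ card S else 0)"
    by (rule sum.swap)
  \<comment> \<open>For a covering tuple only \<open>S = U\<close> remains, with sign (-1)^5; this
    is the minus sign in the statement.\<close>
  also have "\<dots> = (\<Sum>t\<in>U \<times> U \<times> U \<times> U \<times> U. if R t = U then - H t else 0)"
  proof (rule sum.cong[OF refl])
    fix t assume "t \<in> U \<times> U \<times> U \<times> U \<times> U"
    then have "R t \<subseteq> U" by (auto simp: R_def)
    have "(\<Sum>S\<in>Pow U. if R t \<subseteq> S then H t * (-1) ^ card S else 0)
        = H t * (\<Sum>S | S \<subseteq> U \<and> R t \<subseteq> S. (-1) ^ card S)"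
      unfolding sum_distrib_left by (rule sum.mono_neutral_cong_right) auto
    then show "(\<Sum>S\<in>Pow U. if R t \<subseteq> S then H t * (-1) ^ card S else 0)
        = (if R t = U then - H t else 0)"
      using sum_alternating_supersets[OF U(1) \<open>R t \<subseteq> U\<close>] by auto
  qed
  also have "\<dots> = (\<Sum>t | R t = U. - H t)"
    by (rule sum.mono_neutral_cong_right) (auto simp: R_def)
  also have "{t. R t = U} = {(i, j, k, l, m). {i, j, k, l, m} = {..<5}}"
    by (auto simp: R_def U_def)
  also have "(\<Sum>t\<in>\<dots>. - H t)
      = - (\<Sum>\<pi> | \<pi> permutes {..<5}. H (\<pi> 0, \<pi> 1, \<pi> 2, \<pi> 3, \<pi> 4))"
    by (simp add: sum_negf sum.reindex_bij_betw[OF bij_betw_permutations_tuples, symmetric])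
  finally show ?thesis
    by (simp add: symmetrise5_def Let_def v_def U_def H_def)
qed

text \<open>The polarisation formula involves \<open>F\<close> only through
  \<open>diag5 F\<close>.\<close>

lemma symmetrise5_eqI:
  fixes F G :: "'a::finite \<Rightarrow> 'a \<Rightarrow> 'a \<Rightarrow> 'a \<Rightarrow> 'a \<Rightarrow> real"
  assumes "\<And>x. diag5 F x = diag5 G x"
  shows "symmetrise5 F a b c p q = symmetrise5 G a b c p q"
  by (simp add: symmetrise5_polarisation assms)

lemma symmetrise5_linear:
  "symmetrise5 (\<lambda>a b c p q. r * F a b c p q + s * G a b c p q) a b c p q
     = r * symmetrise5 F a b c p q + s * symmetrise5 G a b c p q"
  by (simp add: symmetrise5_def Let_def sum.distrib sum_distrib_left[symmetric] add_divide_distrib)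

lemma diag5_linear:
  "diag5 (\<lambda>a b c p q. r * F a b c p q + s * G a b c p q) x = r * diag5 F x + s * diag5 G x"
  by (simp add: diag5_def sum.distrib sum_distrib_left algebra_simps)

lemma diag5_sum:
  "diag5 (\<lambda>a b c p q. \<Sum>u\<in>S. f u a b c p q) x = (\<Sum>u\<in>S. diag5 (f u) x)"
  by (simp add: diag5_def sum_distrib_left sum.swap[of _ S UNIV])

text \<open>The second factor keeps the sum over \<open>c\<close> outside those over
  \<open>p\<close> and \<open>q\<close>, so that an inner contraction of \<open>d\<close> with two
  copies of \<open>x\<close> can be recognised.\<close>

lemma diag5_mult:
  "diag5 (\<lambda>a b c p q. f a b * g c p q) x = (\<Sum>a\<in>UNIV. \<Sum>b\<in>UNIV. x a * (x b * f a b))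
     * (\<Sum>c\<in>UNIV. x c * (\<Sum>p\<in>UNIV. \<Sum>q\<in>UNIV. x p * (x q * g c p q)))"
  by (simp only: diag5_def sum_distrib_right) (simp add: sum_distrib_left mult_ac)

section \<open>Linearity of trace and matrix product, and matrix powers\<close>

lemma trace_scaleR: "trace (r *\<^sub>R A) = r *\<^sub>R trace (A :: 'b::real_algebra_1 ^ 'n ^ 'n)"
  by (simp add: trace_def scaleR_sum_right)

lemma scaleR_of_real_complex: "r *\<^sub>R (of_real s :: complex) = of_real (r * s)"
  by (simp add: scaleR_conv_of_real)

lemma scaleR_complex: "r *\<^sub>R (z :: complex) = of_real r * z"
  by (rule scaleR_conv_of_real)

text \<open>Moves a condition free of the summation index out of the sum, so that nested Kronecker
  conditions collapse.\<close>

lemma sum_if_const: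
  "(\<Sum>i\<in>S. if P then f i else 0) = (if P then sum f S else (0 :: 'b::comm_monoid_add))"
  by simp

lemma trace_sum: "trace (\<Sum>i\<in>S. f i) = (\<Sum>i\<in>S. trace (f i :: 'b::comm_semiring_1 ^ 'n ^ 'n))"
  by (simp add: trace_def sum.swap[of _ S])

lemma matrix_sum_distrib_right:
  "(\<Sum>i\<in>S. f i) ** B = (\<Sum>i\<in>S. f i ** (B :: 'b::semiring_1 ^ 'n ^ 'm))"
  by (simp add: vec_eq_iff matrix_matrix_mult_def sum_distrib_right sum.swap[of _ S])

lemma matrix_sum_distrib_left:
  "B ** (\<Sum>i\<in>S. f i) = (\<Sum>i\<in>S. (B :: 'b::semiring_1 ^ 'n ^ 'm) ** f i)"
  by (simp add: vec_eq_iff matrix_matrix_mult_def sum_distrib_left sum.swap[of _ S])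

lemma matrix_add_rdistrib: "(A + B) ** C = A ** C + B ** (C :: 'b::semiring_1 ^ 'n ^ 'm)"
  by (simp add: vec_eq_iff matrix_matrix_mult_def sum.distrib distrib_right)

lemma matrix_diff_rdistrib: "(A - B) ** C = A ** C - B ** (C :: 'b::ring_1 ^ 'n ^ 'm)"
  by (simp add: vec_eq_iff matrix_matrix_mult_def sum_subtractf left_diff_distrib)

lemma matrix_diff_ldistrib: "C ** (A - B) = C ** A - C ** (B :: 'b::ring_1 ^ 'n ^ 'm)"
  by (simp add: vec_eq_iff matrix_matrix_mult_def sum_subtractf right_diff_distrib)

lemmas matrix_scaleR_left = scalar_matrix_assoc[symmetric]

lemma matrix_scaleR_right:
  fixes A :: "'b::real_algebra_1 ^ 'm ^ 'n"
  shows "A ** (k *\<^sub>R B) = k *\<^sub>R (A ** B)"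
  by (simp add: matrix_matrix_mult_def scaleR_sum_right vec_eq_iff)

text \<open>Factors are appended on the right, so powers unfold to the left-nested products that
  \<open>matrix_mul_assoc\<close> produces.\<close>

primrec matrix_power :: "'b::semiring_1 ^ 'n ^ 'n \<Rightarrow> nat \<Rightarrow> 'b ^ 'n ^ 'n" where
  "matrix_power A 0 = mat 1"
| "matrix_power A (Suc k) = matrix_power A k ** A"

lemma matrix_power_commute: "A ** matrix_power A k = matrix_power A k ** A"
  by (induction k) (simp_all add: matrix_mul_assoc)

lemma matrix_power_add: "matrix_power A (i + j) = matrix_power A i ** matrix_power A j"
  by (induction j) (simp_all add: matrix_mul_assoc)

lemma trace_mult_d_matrices:
  fixes D :: "'a::finite \<Rightarrow> real ^ 'm ^ 'm" and x :: "'a \<Rightarrow> real"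
  defines "M \<equiv> \<Sum>a\<in>UNIV. x a *\<^sub>R D a"
  shows "diag5 (\<lambda>a b c p q. trace (D a ** D b ** D c ** D p ** D q)) x
    = trace (M ** M ** M ** M ** M)"
proof -
  have collapse: "(\<Sum>a\<in>UNIV. x a * trace (A ** D a ** B)) = trace (A ** M ** B)" for A B
    by (simp add: M_def matrix_sum_distrib_left matrix_sum_distrib_right trace_sum
        matrix_scaleR_left matrix_scaleR_right trace_scaleR)
  show ?thesis
    \<comment> \<open>The instances absorb the sums from the innermost index \<open>q\<close>
      outwards: each finds one more \<open>M\<close> on its right, and the last has nothing on its
      left.\<close>
    using collapse[of _ "mat 1"] collapse[of _ M] collapse[of _ "M ** M"]
      collapse[of _ "M ** M ** M"] collapse[of "mat 1" "M ** M ** M ** M"]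
    by (simp add: diag5_def matrix_mul_assoc flip: sum_distrib_left)
qed

section \<open>Generators of su(n) and their completeness relation\<close>

locale su_algebra =
  fixes T :: "'a::finite \<Rightarrow> complex ^ 'n ^ 'n"
    and d :: "'a \<Rightarrow> 'a \<Rightarrow> 'a \<Rightarrow> real"
    and n :: real
  defines n_def: "n \<equiv> real CARD('n)"
  assumes generators: "su_generators T"
    and tensor: "su_d_tensor T d"
begin

lemma n_nonzero [simp]: "n \<noteq> 0" "\<bar>n\<bar> = n"
  by (simp_all add: n_def)

lemma trace_one [simp]: "trace (mat 1 :: complex ^ 'n ^ 'n) = of_real n"
  by (simp add: trace_I n_def)

lemma trace_T [simp]: "trace (T a) = 0"
  using generators by (simp add: su_generators_def)

lemma trace_T_mult: "trace (T a ** T b) = of_real (kdelta a b / 2)"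
  using generators by (simp add: su_generators_def)

lemma anticommutator_T:
  "anticommutator (T a) (T b) = (kdelta a b / n) *\<^sub>R mat 1 + (\<Sum>c\<in>UNIV. d a b c *\<^sub>R T c)"
  using tensor by (simp add: su_d_tensor_def n_def)

text \<open>The rescaled T_a together with the rescaled unit matrix are the n^2 rows of a square matrix A.
  Orthonormality says that A has a right inverse A', and A' A = 1 is the completeness relation.\<close>

lemma completeness:
  "(\<Sum>a\<in>UNIV. T a $ i $ j * T a $ k $ l)
     = (if i = l \<and> j = k then 1 else 0) / 2 - (if i = j \<and> k = l then 1 else 0) / of_real (2 * n)"
proof -
  \<comment> \<open>\<open>None\<close> labels the unit matrix; the factors are chosen so that
    Tr(B_r B_s) is the Kronecker delta.\<close>
  define B where "B r = (case r of None \<Rightarrow> (1 / sqrt n) *\<^sub>R mat 1 | Some a \<Rightarrow> sqrt 2 *\<^sub>R T a)" for r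
  have ortho: "trace (B r ** B s) = (if r = s then 1 else 0)" for r s
    by (auto simp: B_def matrix_scaleR_left matrix_scaleR_right trace_scaleR trace_T_mult
        kdelta_def scaleR_of_real_complex simp del: of_real_divide split: option.splits)
  \<comment> \<open>The subtraction in \<open>CARD('n) ^ 2 - 1\<close> is truncated; this bound lets
    the extra label \<open>None\<close> restore n^2.\<close>
  have "CARD('n) ^ 2 \<ge> 1" by simp
  then have "CARD('n \<times> 'n) = CARD('a option)"
    using generators by (simp add: su_generators_def power2_eq_square)
  then obtain f :: "'n \<times> 'n \<Rightarrow> 'a option" where f: "bij f"
    using finite_same_card_bij[of "UNIV :: ('n \<times> 'n) set" "UNIV :: 'a option set"] by auto
  define A :: "complex ^ ('n \<times> 'n) ^ ('n \<times> 'n)"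
    where "A = (\<chi> r s. B (f r) $ fst s $ snd s)"
  \<comment> \<open>The matrix indices are swapped relative to \<open>A\<close>, so that the entries
    of \<open>A ** A'\<close> are the traces in \<open>ortho\<close>.\<close>
  define A' :: "complex ^ ('n \<times> 'n) ^ ('n \<times> 'n)"
    where "A' = (\<chi> s r. B (f r) $ snd s $ fst s)"
  have "(A ** A') $ r $ s = trace (B (f r) ** B (f s))" for r s
    by (simp add: A_def A'_def matrix_matrix_mult_def trace_def sum.cartesian_product' split_def
        flip: UNIV_Times_UNIV)
  then have "A ** A' = mat 1"
    using f by (simp add: vec_eq_iff ortho mat_def bij_def inj_eq)
  then have "A' ** A = mat 1"
    by (rule matrix_left_right_inverse1)
  then have "(A' ** A) $ (j, i) $ (k, l) = (if i = l \<and> j = k then 1 else 0)"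
    by (auto simp: mat_def)
  moreover have "(A' ** A) $ (j, i) $ (k, l) = (\<Sum>r\<in>UNIV. B (f r) $ i $ j * B (f r) $ k $ l)"
    by (simp add: A_def A'_def matrix_matrix_mult_def)
  moreover have "\<dots> = (\<Sum>r\<in>UNIV. B r $ i $ j * B r $ k $ l)"
    by (rule sum.reindex_bij_betw[OF f])
  moreover have "\<dots> = (if i = j \<and> k = l then 1 else 0) / of_real n
      + 2 * (\<Sum>a\<in>UNIV. T a $ i $ j * T a $ k $ l)"
  proof -
    have "B (Some a) $ i $ j * B (Some a) $ k $ l = 2 * (T a $ i $ j * T a $ k $ l)" for a
      by (simp add: B_def) (simp add: scaleR_complex)
    moreover have "B None $ i $ j * B None $ k $ l = (if i = j \<and> k = l then 1 else 0) / of_real n"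
      by (simp add: B_def mat_def scaleR_complex flip: of_real_mult)
    ultimately show ?thesis
      by (simp add: UNIV_option_conv sum.reindex sum_distrib_left)
  qed
  ultimately show ?thesis
    by (auto simp: field_simps)
qed

text \<open>Completeness amounts to sum_a T_a A T_a = (Tr A)/2 - A/(2n); the leading term splits one
  trace into two.\<close>

lemma sum_trace_sandwich:
  "(\<Sum>a\<in>UNIV. trace (T a ** A ** T a ** B))
     = trace A * trace B / 2 - trace (A ** B) / of_real (2 * n)"
proof -
  have "(\<Sum>a\<in>UNIV. trace (T a ** A ** T a ** B))
      = (\<Sum>a\<in>UNIV. \<Sum>i\<in>UNIV. \<Sum>l\<in>UNIV. \<Sum>k\<in>UNIV. \<Sum>j\<in>UNIV.
          (A $ j $ k * B $ l $ i) * (T a $ i $ j * T a $ k $ l))"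
    by (simp add: trace_def matrix_matrix_mult_def sum_distrib_right sum_distrib_left mult_ac)
  also have "\<dots> = (\<Sum>i\<in>UNIV. \<Sum>l\<in>UNIV. \<Sum>k\<in>UNIV. \<Sum>j\<in>UNIV.
          (A $ j $ k * B $ l $ i) * (\<Sum>a\<in>UNIV. T a $ i $ j * T a $ k $ l))"
    by (simp add: sum.swap[of _ _ "UNIV :: 'a set"] sum_distrib_left)
  also have "\<dots> = (\<Sum>i\<in>UNIV. \<Sum>l\<in>UNIV. \<Sum>k\<in>UNIV. \<Sum>j\<in>UNIV.
          (if i = l then if j = k then A $ j $ k * B $ l $ i / 2 else 0 else 0))
      - (\<Sum>i\<in>UNIV. \<Sum>l\<in>UNIV. \<Sum>k\<in>UNIV. \<Sum>j\<in>UNIV.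
          (if k = l then if j = i then A $ j $ k * B $ l $ i / of_real (2 * n) else 0 else 0))"
    unfolding completeness sum_subtractf[symmetric]
    by (intro sum.cong refl) (auto simp: algebra_simps)
  also have "\<dots> = trace A * trace B / 2 - trace (A ** B) / of_real (2 * n)"
    by (simp add: trace_def matrix_matrix_mult_def sum_distrib_right sum_distrib_left
        sum_divide_distrib sum_if_const cong: if_cong)
  finally show ?thesis .
qed

text \<open>The counterpart of \<open>sum_trace_sandwich\<close>: the leading term of completeness
  now joins two traces into one.\<close>

lemma sum_trace_mult_trace:
  "(\<Sum>a\<in>UNIV. trace (T a ** A) * trace (T a ** B))
     = trace (A ** B) / 2 - trace A * trace B / of_real (2 * n)"
proof -
  have "(\<Sum>a\<in>UNIV. trace (T a ** A) * trace (T a ** B))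
      = (\<Sum>a\<in>UNIV. \<Sum>k\<in>UNIV. \<Sum>i\<in>UNIV. \<Sum>l\<in>UNIV. \<Sum>j\<in>UNIV.
          (A $ j $ i * B $ l $ k) * (T a $ i $ j * T a $ k $ l))"
    by (simp add: trace_def matrix_matrix_mult_def sum_distrib_right sum_distrib_left mult_ac)
  also have "\<dots> = (\<Sum>k\<in>UNIV. \<Sum>i\<in>UNIV. \<Sum>l\<in>UNIV. \<Sum>j\<in>UNIV.
          (A $ j $ i * B $ l $ k) * (\<Sum>a\<in>UNIV. T a $ i $ j * T a $ k $ l))"
    by (simp add: sum.swap[of _ _ "UNIV :: 'a set"] sum_distrib_left)
  also have "\<dots> = (\<Sum>k\<in>UNIV. \<Sum>i\<in>UNIV. \<Sum>l\<in>UNIV. \<Sum>j\<in>UNIV.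
          (if k = j then if l = i then A $ j $ i * B $ l $ k / 2 else 0 else 0))
      - (\<Sum>k\<in>UNIV. \<Sum>i\<in>UNIV. \<Sum>l\<in>UNIV. \<Sum>j\<in>UNIV.
          (if j = i then if l = k then A $ j $ i * B $ l $ k / of_real (2 * n) else 0 else 0))"
    unfolding completeness sum_subtractf[symmetric]
    by (intro sum.cong refl) (auto simp: algebra_simps)
  also have "\<dots> = trace (A ** B) / 2 - trace A * trace B / of_real (2 * n)"
    by (simp add: trace_def matrix_matrix_mult_def sum_distrib_right sum_distrib_left
        sum_divide_distrib sum_if_const cong: if_cong)
  finally show ?thesis .
qed

section \<open>The d-product of coordinate vectors and the symmetry of d\<close>

definition comb :: "('a \<Rightarrow> real) \<Rightarrow> complex ^ 'n ^ 'n" where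
  "comb x = (\<Sum>a\<in>UNIV. x a *\<^sub>R T a)"

text \<open>The coordinates of the traceless part of the anticommutator of \<open>comb x\<close> and
  \<open>comb y\<close>.\<close>

definition d_prod :: "('a \<Rightarrow> real) \<Rightarrow> ('a \<Rightarrow> real) \<Rightarrow> 'a \<Rightarrow> real" where
  "d_prod x y c = (\<Sum>a\<in>UNIV. \<Sum>b\<in>UNIV. x a * (y b * d a b c))"

lemma trace_comb [simp]: "trace (comb x) = 0"
  by (simp add: comb_def trace_sum trace_scaleR)

lemma comb_mult: "comb x ** A = (\<Sum>a\<in>UNIV. x a *\<^sub>R (T a ** A))"
  by (simp add: comb_def matrix_sum_distrib_right matrix_scaleR_left)

lemma mult_comb: "A ** comb x = (\<Sum>a\<in>UNIV. x a *\<^sub>R (A ** T a))"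
  by (simp add: comb_def matrix_sum_distrib_left matrix_scaleR_right)

text \<open>Lets the identities for combinations be applied to a single generator.\<close>

lemma T_eq_comb: "T a = comb (kdelta a)"
  by (simp add: comb_def kdelta_def if_distrib[of "\<lambda>r. r *\<^sub>R _"] cong: if_cong)

lemma trace_comb_T: "trace (comb x ** T a) = of_real (x a / 2)"
proof -
  have "trace (comb x ** T a) = of_real (\<Sum>b\<in>UNIV. kdelta b a * (x b / 2))"
    by (simp add: comb_mult trace_sum trace_scaleR trace_T_mult scaleR_complex mult_ac)
  then show ?thesis by (simp only: sum_kdelta_mult)
qed

lemma trace_comb_mult: "trace (comb x ** comb y) = of_real ((\<Sum>a\<in>UNIV. x a * y a) / 2)"
  by (simp add: mult_comb[of _ y] trace_sum trace_scaleR trace_comb_T scaleR_complex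
      sum_divide_distrib mult_ac)

lemma anticommutator_comb:
  "comb x ** comb y + comb y ** comb x
     = ((\<Sum>a\<in>UNIV. x a * y a) / n) *\<^sub>R mat 1 + comb (d_prod x y)"
proof -
  have prod: "comb x ** comb y = (\<Sum>a\<in>UNIV. \<Sum>b\<in>UNIV. (x a * y b) *\<^sub>R (T a ** T b))" for x y
    by (subst comb_mult) (simp add: mult_comb scaleR_sum_right)
  have prod': "comb y ** comb x = (\<Sum>a\<in>UNIV. \<Sum>b\<in>UNIV. (x a * y b) *\<^sub>R (T b ** T a))"
    unfolding prod by (subst sum.swap) (simp add: mult.commute)
  have "comb x ** comb y + comb y ** comb x
      = (\<Sum>a\<in>UNIV. \<Sum>b\<in>UNIV. (x a * y b) *\<^sub>R anticommutator (T a) (T b))"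
    unfolding prod[of x] prod' by (simp add: anticommutator_def sum.distrib scaleR_add_right)
  also have "\<dots> = (\<Sum>a\<in>UNIV. \<Sum>b\<in>UNIV. (kdelta a b * (x a * y b / n)) *\<^sub>R mat 1)
      + (\<Sum>a\<in>UNIV. \<Sum>b\<in>UNIV. \<Sum>c\<in>UNIV. (x a * (y b * d a b c)) *\<^sub>R T c)"
    by (simp add: anticommutator_T scaleR_add_right sum.distrib scaleR_sum_right mult_ac)
  also have "(\<Sum>a\<in>UNIV. \<Sum>b\<in>UNIV. (kdelta a b * (x a * y b / n)) *\<^sub>R (mat 1 :: complex ^ 'n ^ 'n))
      = ((\<Sum>a\<in>UNIV. x a * y a) / n) *\<^sub>R mat 1"
    by (simp only: sum_divide_distrib sum_kdelta_mult flip: scaleR_sum_left)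
  also have "(\<Sum>a\<in>UNIV. \<Sum>b\<in>UNIV. \<Sum>c\<in>UNIV. (x a * (y b * d a b c)) *\<^sub>R T c)
      = (\<Sum>a\<in>UNIV. \<Sum>c\<in>UNIV. \<Sum>b\<in>UNIV. (x a * (y b * d a b c)) *\<^sub>R T c)"
    by (intro sum.cong refl sum.swap)
  also have "\<dots> = (\<Sum>c\<in>UNIV. \<Sum>a\<in>UNIV. \<Sum>b\<in>UNIV. (x a * (y b * d a b c)) *\<^sub>R T c)"
    by (rule sum.swap)
  also have "\<dots> = comb (d_prod x y)"
    by (simp add: comb_def d_prod_def scaleR_sum_left)
  finally show ?thesis .
qed

text \<open>Tracing the defining relation against \<open>T c\<close> removes the unit-matrix term,
  and orthogonality selects one component of \<open>d\<close>.\<close>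

lemma d_eq_trace: "of_real (d a b c) = 2 * trace (T a ** T b ** T c + T b ** T a ** T c)"
proof -
  have "T a ** T b ** T c + T b ** T a ** T c = anticommutator (T a) (T b) ** T c"
    by (simp add: anticommutator_def matrix_add_rdistrib)
  also have "trace \<dots> = of_real (\<Sum>e\<in>UNIV. kdelta e c * (d a b e / 2))"
    by (simp add: anticommutator_T matrix_add_rdistrib matrix_sum_distrib_right matrix_scaleR_left
        trace_add trace_sum trace_scaleR trace_T_mult scaleR_complex mult_ac)
  also have "\<dots> = of_real (d a b c) / 2"
    unfolding sum_kdelta_mult by simp
  finally have *: "trace (T a ** T b ** T c + T b ** T a ** T c) = of_real (d a b c) / 2" .
  show ?thesis unfolding * by simp
qed

text \<open>Cyclicity of the trace preserves each of the two orderings in \<open>d_eq_trace\<close>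
  up to rotation.\<close>

lemma d_cyclic: "d a b c = d b c a"
proof -
  have "trace (T a ** T b ** T c) = trace (T b ** T c ** T a)"
    "trace (T b ** T a ** T c) = trace (T c ** T b ** T a)"
    by (metis matrix_mul_assoc trace_mul_sym)+
  then have "complex_of_real (d a b c) = of_real (d b c a)"
    by (simp add: d_eq_trace trace_add)
  then show ?thesis by (simp only: of_real_eq_iff)
qed

section \<open>The fifth trace of the D matrices\<close>

text \<open>One step of the recursion for the functionals u k b Z = (M^k)_bc Tr (T_c Z): since
  u 5 b (T_b) = (M^5)_bb / 2, iterating it reduces Tr M^5 to traces of products of X and T_b.\<close>

lemma sum_d_matrix_trace:
  fixes x :: "'a \<Rightarrow> real"
  defines "M \<equiv> \<Sum>a\<in>UNIV. x a *\<^sub>R d_matrix d a" and "X \<equiv> comb x"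
  shows "(\<Sum>c\<in>UNIV. of_real (M $ b $ c) * trace (T c ** Z))
    = trace (T b ** (X ** Z + Z ** X)) - 2 / of_real n * trace (T b ** X) * trace Z"
proof -
  have M: "M $ b $ c = d_prod x (kdelta b) c" for c
    by (simp add: M_def d_matrix_def d_prod_def flip: sum_distrib_left)
  have "(\<Sum>c\<in>UNIV. of_real (M $ b $ c) * trace (T c ** Z)) = trace (comb (d_prod x (kdelta b)) ** Z)"
    by (simp add: M comb_mult trace_sum trace_scaleR scaleR_complex)
  also have "comb (d_prod x (kdelta b)) = X ** T b + T b ** X - (x b / n) *\<^sub>R mat 1"
    using anticommutator_comb[of x "kdelta b"]
    by (simp add: X_def T_eq_comb[of b] mult.commute[of "x _"])
  also have "trace (\<dots> ** Z)
      = trace (X ** T b ** Z) + trace (T b ** X ** Z) - of_real (x b / n) * trace Z"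
    by (simp add: matrix_diff_rdistrib matrix_add_rdistrib trace_sub trace_add matrix_scaleR_left
        trace_scaleR scaleR_complex)
  also have "trace (X ** T b ** Z) = trace (T b ** Z ** X)"
    by (metis matrix_mul_assoc trace_mul_sym)
  \<comment> \<open>Expressing \<open>x b\<close> through Tr(T_b X) keeps the right-hand side within
    functionals of the form Tr(T_b Z), so the step can be iterated.\<close>
  also have "of_real (x b / n) = 2 / of_real n * trace (T b ** X)"
    by (simp add: trace_mul_sym[of "T b"] X_def trace_comb_T)
  finally show ?thesis
    by (simp add: matrix_add_ldistrib trace_add matrix_mul_assoc)
qed

lemma trace_d_matrix_power5:
  fixes x :: "'a \<Rightarrow> real"
  defines "M \<equiv> \<Sum>a\<in>UNIV. x a *\<^sub>R d_matrix d a"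
    and "t \<equiv> \<lambda>k. trace (matrix_power (comb x) k)"
  shows "of_real (trace (M ** M ** M ** M ** M))
    = (2 * of_real n - 160 / of_real n) * t 5 + (20 + 160 / (of_real n)\<^sup>2) * t 2 * t 3"
proof -
  define X where "X = comb x"
  define N where "N = complex_of_real n"
  define u where "u k b Z = (\<Sum>c\<in>UNIV. of_real (matrix_power M k $ b $ c) * trace (T c ** Z))"
    for k b Z
  define \<tau> where "\<tau> b k = trace (T b ** matrix_power X k)" for b k
  define s where "s b i j = trace (T b ** matrix_power X i ** T b ** matrix_power X j)" for b i j
  \<comment> \<open>Powers of X and these words with one T_b are the only arguments that occur: XZ +
    ZX turns a power into twice the next one and a word into two longer words.\<close>
  define w where "w b i j = matrix_power X i ** T b ** matrix_power X j" for b i j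
  have N [simp]: "N \<noteq> 0" by (simp add: N_def)
  have t0: "t 0 = N" and t1: "t 1 = 0"
    by (simp_all add: t_def N_def)
  have \<tau>0: "\<tau> b 0 = 0" for b
    by (simp add: \<tau>_def)
  have u0: "u 0 b Z = trace (T b ** Z)" for b Z
  proof -
    have "u 0 b Z = (\<Sum>c\<in>UNIV. if c = b then trace (T b ** Z) else 0)"
      unfolding u_def by (intro sum.cong) (auto simp: mat_def)
    then show ?thesis by simp
  qed
  have u_Suc: "u (Suc k) b Z = u k b (X ** Z + Z ** X) - 2 / N * u k b X * trace Z" for k b Z
  proof -
    have "u (Suc k) b Z = (\<Sum>c\<in>UNIV. \<Sum>e\<in>UNIV. of_real (matrix_power M k $ b $ e)
        * (of_real (M $ e $ c) * trace (T c ** Z)))"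
      by (simp add: u_def matrix_matrix_mult_def sum_distrib_right mult.assoc)
    also have "\<dots> = (\<Sum>e\<in>UNIV. of_real (matrix_power M k $ b $ e)
        * (\<Sum>c\<in>UNIV. of_real (M $ e $ c) * trace (T c ** Z)))"
      by (subst sum.swap) (simp add: sum_distrib_left)
    also have "\<dots> = u k b (X ** Z + Z ** X) - 2 / N * u k b X * trace Z"
      unfolding M_def sum_d_matrix_trace u_def X_def[symmetric] N_def
      by (simp add: sum_subtractf sum_distrib_left sum_distrib_right algebra_simps)
    finally show ?thesis .
  qed
  have u_add: "u k b (Y + Z) = u k b Y + u k b Z" for k b Y Z
    by (simp add: u_def matrix_add_ldistrib trace_add algebra_simps sum.distrib)
  have u0_power: "u 0 b (matrix_power X i) = \<tau> b i" for b i
    by (simp add: u0 \<tau>_def)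
  have u_power: "u (Suc k) b (matrix_power X i)
      = 2 * u k b (matrix_power X (Suc i)) - 2 / N * u k b (matrix_power X 1) * t i" for k b i
  proof -
    have "X ** matrix_power X i + matrix_power X i ** X
        = matrix_power X (Suc i) + matrix_power X (Suc i)"
      by (simp only: matrix_power.simps matrix_power_commute)
    then show ?thesis
      by (simp only: u_Suc u_add t_def X_def) (simp add: X_def)
  qed
  have u0_w: "u 0 b (w b i j) = s b i j" for b i j
    by (simp add: u0 w_def s_def matrix_mul_assoc)
  have trace_w: "trace (w b i j) = \<tau> b (i + j)" for b i j
    unfolding w_def \<tau>_def add.commute[of i] matrix_power_add
    by (metis matrix_mul_assoc trace_mul_sym)
  have u_w: "u (Suc k) b (w b i j) = u k b (w b (Suc i) j) + u k b (w b i (Suc j))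
      - 2 / N * u k b (matrix_power X 1) * \<tau> b (i + j)" for k b i j
  proof -
    have "X ** w b i j = w b (Suc i) j" "w b i j ** X = w b i (Suc j)"
      by (simp_all add: w_def matrix_mul_assoc matrix_power_commute)
    then show ?thesis
      by (simp add: u_Suc u_add trace_w)
  qed
  \<comment> \<open>The binomial coefficients count the sides on which the five factors X are
    placed. The other terms come from the trace corrections, where 2^m words of length m share the
    trace \<open>\<tau> b m\<close>; terms with \<open>t 1\<close> or \<open>\<tau> b 0\<close>
    vanish.\<close>
  have u5: "u 5 b (w b 0 0) = s b 5 0 + 5 * s b 4 1 + 10 * s b 3 2 + 10 * s b 2 3 + 5 * s b 1 4
      + s b 0 5 - 64 / N * (\<tau> b 1 * \<tau> b 4) - 64 / N * (\<tau> b 2 * \<tau> b 3)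
      + 64 / N\<^sup>2 * t 2 * (\<tau> b 1 * \<tau> b 2) + 32 / N\<^sup>2 * t 3 * (\<tau> b 1 * \<tau> b 1)" for b
    using t1 \<tau>0
    by (simp add: eval_nat_numeral u_w u_power u0_w u0_power del: matrix_power.simps)
       (simp add: field_simps)
  have S: "(\<Sum>b\<in>UNIV. s b i j) = t i * t j / 2 - t (i + j) / (2 * N)" for i j
    unfolding s_def sum_trace_sandwich by (simp add: t_def X_def N_def matrix_power_add)
  have R: "(\<Sum>b\<in>UNIV. \<tau> b i * \<tau> b j) = t (i + j) / 2 - t i * t j / (2 * N)" for i j
    unfolding \<tau>_def sum_trace_mult_trace by (simp add: t_def X_def N_def matrix_power_add)
  \<comment> \<open>The word \<open>w b 0 0\<close> is T_b itself, and Tr(T_c T_b) selects the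
    diagonal entry with weight 1/2.\<close>
  have "of_real (matrix_power M 5 $ b $ b) = 2 * u 5 b (w b 0 0)" for b
  proof -
    have "2 * u 5 b (w b 0 0) = of_real (\<Sum>c\<in>UNIV. kdelta c b * matrix_power M 5 $ b $ c)"
      by (simp add: u_def w_def trace_T_mult sum_distrib_left mult_ac del: sum_kdelta_mult)
    then show ?thesis unfolding sum_kdelta_mult by simp
  qed
  moreover have "M ** M ** M ** M ** M = matrix_power M 5"
    by (simp add: eval_nat_numeral)
  ultimately have "of_real (trace (M ** M ** M ** M ** M)) = 2 * (\<Sum>b\<in>UNIV. u 5 b (w b 0 0))"
    by (simp add: trace_def sum_distrib_left)
  \<comment> \<open>The term 2N comes from \<open>s b 5 0\<close> and \<open>s b 0 5\<close>, where
    Tr X^0 = N. In 160 = 2 (16 + 64), 16 is half the sum of the binomial coefficients and 64 comes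
    from the products of two \<open>\<tau>\<close>.\<close>
  also have "\<dots> = (2 * N - 160 / N) * t 5 + (20 + 160 / N\<^sup>2) * t 2 * t 3"
    unfolding u5 sum.distrib sum_subtractf sum_distrib_left[symmetric] S R using t0 t1
    by (simp add: field_simps power2_eq_square eval_nat_numeral)
  finally show ?thesis by (simp add: N_def)
qed

section \<open>The contractions on the right-hand side\<close>

lemma
  fixes x :: "'a \<Rightarrow> real"
  defines "t \<equiv> \<lambda>k. trace (matrix_power (comb x) k)"
  shows diag5_d5: "of_real (diag5 (d5_tensor d) x) = 16 * (t 5 - 2 * t 2 * t 3 / of_real n)"
    and diag5_kdelta_d:
      "of_real (diag5 (\<lambda>a b c p q. kdelta a b * d c p q) x) = 8 * t 2 * t 3"
proof -
  define X where "X = comb x"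
  define y where "y = d_prod x x"
  define Y where "Y = comb y"
  define r where "r = (\<Sum>a\<in>UNIV. x a * x a)"
  have [simp]: "trace X = 0" "trace Y = 0" by (simp_all add: X_def Y_def)
  have t: "t 2 = trace (X ** X)" "t 3 = trace (X ** X ** X)" "t 5 = trace (X ** X ** X ** X ** X)"
    by (simp_all add: t_def X_def eval_nat_numeral)
  have r: "of_real r = 2 * t 2"
    unfolding t X_def trace_comb_mult by (simp add: r_def)
  \<comment> \<open>Since r = 2 t_2, Y is twice the traceless part of X^2; this turns all
    d-contractions into traces of powers of X.\<close>
  have Y: "Y = 2 *\<^sub>R (X ** X) - (r / n) *\<^sub>R mat 1"
    using anticommutator_comb[of x x] by (simp add: Y_def X_def y_def r_def scaleR_2)
  have y: "(\<Sum>a\<in>UNIV. \<Sum>b\<in>UNIV. x a * (x b * d a b u)) = y u"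
    "(\<Sum>p\<in>UNIV. \<Sum>q\<in>UNIV. x p * (x q * d v p q)) = y v" for u v
    by (simp_all add: y_def d_prod_def d_cyclic[of v])
  have "diag5 (d5_tensor d) x
      = (\<Sum>u\<in>UNIV. \<Sum>v\<in>UNIV. diag5 (\<lambda>a b c p q. d a b u * (d u c v * d v p q)) x)"
    by (simp add: d5_tensor_def[abs_def] diag5_sum mult.assoc)
  also have "\<dots> = (\<Sum>u\<in>UNIV. \<Sum>v\<in>UNIV. \<Sum>c\<in>UNIV. y u * (x c * d u c v) * y v)"
  proof -
    have "(\<Sum>p\<in>UNIV. \<Sum>q\<in>UNIV. x p * (x q * (d u c v * d v p q))) = d u c v * y v" for u c v
      by (simp add: y(2)[symmetric] sum_distrib_left mult_ac)
    then show ?thesis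
      by (simp only: diag5_mult y(1)) (simp add: sum_distrib_left mult_ac)
  qed
  \<comment> \<open>The outer two d tensors have become y, and the middle one multiplies y by
    x.\<close>
  also have "\<dots> = (\<Sum>v\<in>UNIV. d_prod y x v * y v)"
    by (subst sum.swap) (simp add: d_prod_def sum_distrib_right)
  also have "complex_of_real \<dots> = 2 * trace (comb (d_prod y x) ** Y)"
    unfolding Y_def trace_comb_mult by simp
  also have "comb (d_prod y x) = Y ** X + X ** Y - ((\<Sum>a\<in>UNIV. y a * x a) / n) *\<^sub>R mat 1"
    using anticommutator_comb[of y x] by (simp add: X_def Y_def)
  \<comment> \<open>The scalar part drops out because Tr Y = 0, and the two orderings agree by
    cyclicity.\<close>
  also have "2 * trace (\<dots> ** Y) = 4 * trace (X ** Y ** Y)"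
  proof -
    have "trace (Y ** X ** Y) = trace (X ** Y ** Y)"
      by (metis matrix_mul_assoc trace_mul_sym)
    then show ?thesis
      by (simp add: matrix_diff_rdistrib matrix_add_rdistrib trace_sub trace_add matrix_scaleR_left
          trace_scaleR)
  qed
  also have "\<dots> = 16 * (t 5 - 2 * t 2 * t 3 / of_real n)"
    by (simp add: Y matrix_diff_rdistrib matrix_diff_ldistrib trace_sub matrix_scaleR_left
        matrix_scaleR_right trace_scaleR scaleR_complex matrix_mul_assoc r flip: t)
  finally show "of_real (diag5 (d5_tensor d) x) = 16 * (t 5 - 2 * t 2 * t 3 / of_real n)" .
  have "diag5 (\<lambda>a b c p q. kdelta a b * d c p q) x = r * (\<Sum>c\<in>UNIV. x c * y c)"
  proof -
    have "(\<Sum>b\<in>UNIV. x a * (x b * kdelta a b)) = x a * x a" for a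
      by (simp add: mult.commute[of _ "kdelta _ _"] flip: sum_distrib_left)
    then show ?thesis
      by (simp add: diag5_mult y(2) r_def)
  qed
  also have "complex_of_real \<dots> = 2 * t 2 * (2 * trace (X ** Y))"
    unfolding X_def Y_def trace_comb_mult of_real_mult r by simp
  also have "trace (X ** Y) = 2 * t 3"
    by (simp add: Y matrix_diff_ldistrib trace_sub matrix_scaleR_right trace_scaleR scaleR_complex
        matrix_mul_assoc flip: t)
  finally show "of_real (diag5 (\<lambda>a b c p q. kdelta a b * d c p q) x) = 8 * t 2 * t 3"
    by simp
qed

end

section \<open>Comparison of the two sides\<close>

theorem mainTheorem15:
  fixes T :: "'a::finite \<Rightarrow> complex ^ 'n ^ 'n"
    and d :: "'a \<Rightarrow> 'a \<Rightarrow> 'a \<Rightarrow> real"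
    and a b c p q :: 'a
  assumes "su_generators T"
    and "su_d_tensor T d"
  defines "n \<equiv> real CARD('n)"
    and "D \<equiv> d_matrix d"
  shows "symmetrise5 (\<lambda>a b c p q. trace (D a ** D b ** D c ** D p ** D q)) a b c p q
       = (n ^ 2 - 80) / (8 * n) * symmetrise5 (d5_tensor d) a b c p q
         + (3 * n ^ 2 - 20) / n ^ 2 * symmetrise5 (\<lambda>a b c p q. kdelta a b * d c p q) a b c p q"
proof -
  interpret su_algebra T d n
    by unfold_locales (fact assms n_def)+
  show ?thesis
    unfolding symmetrise5_linear[symmetric]
  proof (rule symmetrise5_eqI)
    fix x :: "'a \<Rightarrow> real"
    \<comment> \<open>The comparison is made over the complex numbers, where the t_k live. The
      coefficients of t_2 t_3 agree because -4 (n^2 - 80)/n^2 + 8 (3 n^2 - 20)/n^2 = 20 +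
      160/n^2.\<close>
    have "complex_of_real (diag5 (\<lambda>a b c p q. trace (D a ** D b ** D c ** D p ** D q)) x)
        = of_real ((n ^ 2 - 80) / (8 * n) * diag5 (d5_tensor d) x
          + (3 * n ^ 2 - 20) / n ^ 2 * diag5 (\<lambda>a b c p q. kdelta a b * d c p q) x)"
      unfolding of_real_add of_real_mult diag5_d5 diag5_kdelta_d trace_mult_d_matrices D_def
        trace_d_matrix_power5
      by (simp add: field_simps power2_eq_square)
    then show "diag5 (\<lambda>a b c p q. trace (D a ** D b ** D c ** D p ** D q)) x
        = diag5 (\<lambda>a b c p q. (n ^ 2 - 80) / (8 * n) * d5_tensor d a b c p q
          + (3 * n ^ 2 - 20) / n ^ 2 * (kdelta a b * d c p q)) x"
      by (simp only: of_real_eq_iff diag5_linear)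
  qed
qed

end
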